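(* Let $p,q\in\mathbb{R}$ with $p<0$. Then the reduced cubic equation $x^3+px+q=0$ can be written in the Tusi form $$\alpha^3-\alpha^2+\frac{4}{27}\delta=0,\qquad \delta=\frac12+\frac{3\sqrt3\,q}{4\sqrt{-p^3}}.$$ Conversely, for every $\delta\in\mathbb{R}$, the reduced form of the Tusi form $\alpha^3-\alpha^2+\frac{4}{27}\delta=0$ is $$x^3-\frac13x+\frac{4\delta-2}{27}=0.$$
   Context: A cubic equation in $x$ with real coefficients "can be written" as another cubic equation in $\alpha$ if there is an affine substitution $x=a\alpha+b$ with $a,b\in\mathbb{R}$, $a\neq0$, under which the first polynomial becomes a nonzero real constant times the second polynomial. A cubic equation is in Tusi form if it is $\alpha^3-\alpha^2+\frac{4}{27}\delta=0$ for some $\delta\in\mathbb{R}$. A cubic equation is in reduced form if it is $x^3+px+q=0$ with $p,q\in\mathbb{R}$; the reduced form of a monic real cubic is the one obtained from it by the translation of the variable that eliminates the quadratic term. *)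

theory Defs
  imports Complex_Main "HOL-Computational_Algebra.Polynomial"
begin

text \<open>A cubic equation \<open>P = 0\<close> is represented by the polynomial \<open>P\<close>.\<close>

definition reduced_cubic :: "real \<Rightarrow> real \<Rightarrow> real poly" where
  "reduced_cubic p q = [:q, p, 0, 1:]"

definition tusi_cubic :: "real \<Rightarrow> real poly" where
  "tusi_cubic \<delta> = [:4 / 27 * \<delta>, 0, -1, 1:]"

definition can_be_written :: "real poly \<Rightarrow> real poly \<Rightarrow> bool" where
  "can_be_written P Q \<longleftrightarrow>
     (\<exists>a b c. a \<noteq> 0 \<and> c \<noteq> 0 \<and> P \<circ>\<^sub>p [:b, a:] = smult c Q)"

text \<open>
  Meaningful for monic cubics \<open>P\<close>, for which exactly one translation \<open>x \<mapsto> x + h\<close>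
  removes the quadratic term.
\<close>
definition reduced_form :: "real poly \<Rightarrow> real poly" where
  "reduced_form P = (THE R. (\<exists>h. R = P \<circ>\<^sub>p [:h, 1:]) \<and> (\<exists>p q. R = reduced_cubic p q))"

end

theory Submission
  imports Defs
begin

lemma reduced_cubic_pcompose_linear:
  "reduced_cubic p q \<circ>\<^sub>p [:b, a:] =
     [:b ^ 3 + p * b + q, 3 * a * b ^ 2 + p * a, 3 * a ^ 2 * b, a ^ 3:]"
  by (simp add: reduced_cubic_def pcompose_pCons power2_eq_square power3_eq_cube algebra_simps)

lemma tusi_cubic_pcompose_translation:
  "tusi_cubic \<delta> \<circ>\<^sub>p [:h, 1:] =
     [:h ^ 3 - h ^ 2 + 4 / 27 * \<delta>, 3 * h ^ 2 - 2 * h, 3 * h - 1, 1:]"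
  by (simp add: tusi_cubic_def pcompose_pCons power2_eq_square power3_eq_cube algebra_simps)

text \<open>
  Matching the quadratic coefficients forces \<open>b = - a / 3\<close>, and the vanishing of the
  linear one forces \<open>a\<^sup>2 = - 3 p\<close>; the root \<open>a > 0\<close> yields the sign of \<open>q\<close> in \<open>\<delta>\<close>.
\<close>
lemma reduced_cubic_can_be_written_tusi:
  assumes "p < 0"
  shows "can_be_written (reduced_cubic p q)
           (tusi_cubic (1 / 2 + 3 * sqrt 3 * q / (4 * sqrt (- (p ^ 3)))))"
proof -
  define s where "s = sqrt (- p)"
  define a where "a = sqrt 3 * s"
  have s: "s > 0" and p: "p = - (s ^ 2)"
    using assms by (simp_all add: s_def)
  \<comment> \<open>Since \<open>s > 0\<close>, \<open>s ^ 3\<close> is the nonnegative square root,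
    which turns the radical in \<delta> into a power of \<open>s\<close>.\<close>
  have "(s ^ 3) ^ 2 = - (p ^ 3)"
    by (simp add: p flip: power_mult)
  then have sqrt_p: "sqrt (- (p ^ 3)) = s ^ 3"
    using s by (intro real_sqrt_unique) simp_all
  have a: "a \<noteq> 0" and a2: "a ^ 2 = 3 * s ^ 2" and a3: "a ^ 3 = 3 * sqrt 3 * s ^ 3"
    using s by (simp_all add: a_def power_mult_distrib power3_eq_cube)
  define d where "d = 3 * sqrt 3 * q / (4 * s ^ 3)"
  \<comment> \<open>Rewriting \<open>p\<close> and \<open>q\<close> through \<open>a\<close> and
    \<open>d\<close> removes all radicals: the substitution becomes a polynomial identity. Its
    constant term is \<open>2 / 27 * a ^ 3 + q\<close>, where the first summand accounts for the
    \<open>1 / 2\<close> in \<delta>.\<close>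
  have p_a: "p = - (a ^ 2) / 3"
    by (simp add: p a2)
  have q_a: "q = 4 / 27 * (a ^ 3 * d)"
    using s by (simp add: a3 d_def field_simps)
  have "reduced_cubic p q \<circ>\<^sub>p [:- a / 3, a:] = smult (a ^ 3) (tusi_cubic (1 / 2 + d))"
    unfolding reduced_cubic_pcompose_linear tusi_cubic_def p_a q_a
    by (simp add: power2_eq_square power3_eq_cube field_simps)
  then have "reduced_cubic p q \<circ>\<^sub>p [:- a / 3, a:] =
      smult (a ^ 3) (tusi_cubic (1 / 2 + 3 * sqrt 3 * q / (4 * sqrt (- (p ^ 3)))))"
    by (simp only: d_def sqrt_p)
  then show ?thesis
    using a unfolding can_be_written_def by (metis power_not_zero)
qed

text \<open>The definite description needs a witness, the translation by \<open>1 / 3\<close>, and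
  its uniqueness.\<close>

lemma reduced_form_tusi_cubic:
  "reduced_form (tusi_cubic \<delta>) = reduced_cubic (- (1 / 3)) ((4 * \<delta> - 2) / 27)"
proof -
  have eq: "tusi_cubic \<delta> \<circ>\<^sub>p [:1 / 3, 1:] = reduced_cubic (- (1 / 3)) ((4 * \<delta> - 2) / 27)"
    unfolding tusi_cubic_pcompose_translation reduced_cubic_def
    by (simp add: power2_eq_square power3_eq_cube field_simps)
  \<comment> \<open>The quadratic coefficient \<open>3 * h - 1\<close> must vanish, whatever
    \<open>p\<close> and \<open>q\<close> are.\<close>
  have "h = 1 / 3" if "tusi_cubic \<delta> \<circ>\<^sub>p [:h, 1:] = reduced_cubic p q" for h p q
    using that unfolding tusi_cubic_pcompose_translation reduced_cubic_def by simp
  with eq show ?thesis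
    unfolding reduced_form_def by (intro the_equality) metis+
qed

theorem theorem3:
  shows "(\<forall>p q :: real. p < 0 \<longrightarrow>
            can_be_written (reduced_cubic p q)
              (tusi_cubic (1 / 2 + 3 * sqrt 3 * q / (4 * sqrt (- (p ^ 3)))))) \<and>
         (\<forall>\<delta> :: real.
            reduced_form (tusi_cubic \<delta>) = reduced_cubic (- (1 / 3)) ((4 * \<delta> - 2) / 27))"
  using reduced_cubic_can_be_written_tusi reduced_form_tusi_cubic by blast

end
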